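(* Let $n\ge1$ be an integer and let $W(3,n)$ be the weaving link, i.e. the closure of the 3-braid $(\sigma_1\sigma_2^{-1})^n$. The zeroes of the Alexander polynomial $\Delta_{W(3,n)}(t)$ are of the form $$z=-\frac12\left(2\cos\!\left(\frac{2k}{n}\pi\right)-1\pm\sqrt{\left(2\cos\!\left(\frac{2k}{n}\pi\right)-1\right)^2-4}\,\right),\qquad 1\le k\le\lfloor n/2\rfloor .$$
   Context: $B_3=\langle\sigma_1,\sigma_2\mid \sigma_1\sigma_2\sigma_1=\sigma_2\sigma_1\sigma_2\rangle$ is the braid group on 3 strands. The (reduced) Burau representation $\psi_t:B_3\to GL(2,\mathbb{Z}[t,t^{-1}])$ is given by $$\psi_t(\sigma_1)=\begin{pmatrix}-t&1\\0&1\end{pmatrix},\qquad \psi_t(\sigma_2)=\begin{pmatrix}1&0\\t&-t\end{pmatrix}.$$ For a 3-braid $b$ with exponent sum $e_b$, the Alexander polynomial of the closure $L=\hat b$ is, up to multiplication by a unit of $\mathbb{Z}[t,t^{-1}]$, $$\Delta_L(t)=(-1/\sqrt t)^{e_b-2}\,\frac{1-t}{1-t^3}\,\det\bigl(I_2-\psi_t(b)\bigr).$$ Zeroes are (nonzero) complex zeroes, which do not depend on the choice of unit. When the quantity under the square root is negative, the square root denotes either complex square root. *)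

theory Defs
  imports "HOL-Analysis.Analysis" "HOL-Library.Poly_Mapping"
begin

section \<open>The braid group on three strands\<close>

datatype braid_gen = S1 | S2

(* The letter (g, False) is the generator g, the letter (g, True) its formal inverse. *)
type_synonym braid_word = "(braid_gen \<times> bool) list"

inductive braid_equiv :: "braid_word \<Rightarrow> braid_word \<Rightarrow> bool" where
  be_refl: "braid_equiv u u"
| be_sym: "braid_equiv u v \<Longrightarrow> braid_equiv v u"
| be_trans: "braid_equiv u v \<Longrightarrow> braid_equiv v w \<Longrightarrow> braid_equiv u w"
| be_context: "braid_equiv u v \<Longrightarrow> braid_equiv (x @ u @ y) (x @ v @ y)"
| be_cancel: "braid_equiv [(g, e), (g, \<not> e)] []"
| be_braid: "braid_equiv [(S1, False), (S2, False), (S1, False)] [(S2, False), (S1, False), (S2, False)]"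

lemma braid_equiv_append:
  assumes "braid_equiv u u'" "braid_equiv v v'"
  shows "braid_equiv (u @ v) (u' @ v')"
proof -
  have "braid_equiv (u @ v) (u' @ v)"
    using be_context[OF assms(1), of "[]" v] by simp
  moreover have "braid_equiv (u' @ v) (u' @ v')"
    using be_context[OF assms(2), of u' "[]"] by simp
  ultimately show ?thesis by (rule be_trans)
qed

definition inverse_word :: "braid_word \<Rightarrow> braid_word" where
  "inverse_word w = rev (map (\<lambda>(g, e). (g, \<not> e)) w)"

lemma inverse_word_simps:
  "inverse_word [] = []"
  "inverse_word ((g, e) # w) = inverse_word w @ [(g, \<not> e)]"
  "inverse_word (u @ v) = inverse_word v @ inverse_word u"
  by (simp_all add: inverse_word_def)

lemma inverse_word_left: "braid_equiv (inverse_word w @ w) []"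
proof (induction w)
  case Nil
  show ?case by (simp add: inverse_word_simps be_refl)
next
  case (Cons l w)
  obtain g e where l: "l = (g, e)" by (cases l)
  have "braid_equiv (inverse_word w @ [(g, \<not> e), (g, \<not> \<not> e)] @ w) (inverse_word w @ [] @ w)"
    by (rule be_context, rule be_cancel)
  then show ?case
    using Cons.IH be_trans l by (fastforce simp: inverse_word_simps)
qed

lemma inverse_word_inverse_word: "inverse_word (inverse_word w) = w"
proof -
  have "(\<lambda>(g, e). (g, \<not> e)) \<circ> (\<lambda>(g :: braid_gen, e). (g, \<not> e)) = id"
    by auto
  then show ?thesis by (simp add: inverse_word_def rev_map)
qed

lemma braid_equiv_inverse_word:
  assumes "braid_equiv u v"
  shows "braid_equiv (inverse_word u) (inverse_word v)"
proof -
  have 1: "braid_equiv (inverse_word u @ v) []"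
    using braid_equiv_append[OF be_refl be_sym[OF assms], of "inverse_word u"] inverse_word_left
    by (blast intro: be_trans)
  have 2: "braid_equiv (v @ inverse_word v) []"
    using inverse_word_left[of "inverse_word v"] by (simp add: inverse_word_inverse_word)
  have "braid_equiv (inverse_word u @ (v @ inverse_word v)) (inverse_word u)"
    using braid_equiv_append[OF be_refl 2, of "inverse_word u"] by simp
  moreover have "braid_equiv ((inverse_word u @ v) @ inverse_word v) (inverse_word v)"
    using braid_equiv_append[OF 1 be_refl, of "inverse_word v"] by simp
  ultimately show ?thesis
    by (metis append.assoc be_sym be_trans)
qed

quotient_type braid3 = braid_word / braid_equiv
  by (intro equivpI reflpI sympI transpI) (blast intro: braid_equiv.intros)+

instantiation braid3 :: "{monoid_mult, inverse}"
begin

lift_definition one_braid3 :: braid3 is "[]" .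

lift_definition times_braid3 :: "braid3 \<Rightarrow> braid3 \<Rightarrow> braid3" is "(@)"
  by (rule braid_equiv_append)

lift_definition inverse_braid3 :: "braid3 \<Rightarrow> braid3" is inverse_word
  by (rule braid_equiv_inverse_word)

definition divide_braid3 :: "braid3 \<Rightarrow> braid3 \<Rightarrow> braid3" where
  "divide_braid3 a b = a * inverse b"

instance
  by standard (transfer; simp add: be_refl)+

end

lemma group_braid3: "group ((*) :: braid3 \<Rightarrow> braid3 \<Rightarrow> braid3) 1 inverse"
proof
  fix a :: braid3
  show "inverse a * a = 1"
    by transfer (rule inverse_word_left)
qed simp

lift_definition sigma1 :: braid3 is "[(S1, False)]" .
lift_definition sigma2 :: braid3 is "[(S2, False)]" .

lemma braid_relation: "sigma1 * sigma2 * sigma1 = sigma2 * sigma1 * sigma2"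
  by transfer (simp add: be_braid)

definition exponent_sum_word :: "braid_word \<Rightarrow> int" where
  "exponent_sum_word w = (\<Sum>(g, e) \<leftarrow> w. if e then - 1 else 1)"

lift_definition exponent_sum :: "braid3 \<Rightarrow> int" is exponent_sum_word
proof -
  fix u v :: braid_word
  assume "braid_equiv u v"
  then show "exponent_sum_word u = exponent_sum_word v"
    by induction (auto simp: exponent_sum_word_def)
qed

definition weaving_braid :: "nat \<Rightarrow> braid3" where
  "weaving_braid n = (sigma1 * inverse sigma2) ^ n"

section \<open>Laurent polynomials\<close>

(* Finitely supported functions from exponents to coefficients; the multiplication of
   the library on this type is convolution, so this is the ring of integer Laurent
   polynomials in one variable. *)
type_synonym laurent = "int \<Rightarrow>\<^sub>0 int"

abbreviation lmonom :: "int \<Rightarrow> int \<Rightarrow> laurent" where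
  "lmonom k c \<equiv> Poly_Mapping.single k c"

definition T :: laurent where
  "T = lmonom 1 1"

definition laurent_eval :: "laurent \<Rightarrow> complex \<Rightarrow> complex" where
  "laurent_eval p z = (\<Sum>k \<in> Poly_Mapping.keys p. of_int (Poly_Mapping.lookup p k) * z powi k)"

(* The inclusion of Z[t, 1/t] into Z[s, 1/s], where s = sqrt t, i.e. p(t) is sent to p(s^2). *)
definition in_sqrt :: "laurent \<Rightarrow> laurent" where
  "in_sqrt p = (\<Sum>k \<in> Poly_Mapping.keys p. lmonom (2 * k) (Poly_Mapping.lookup p k))"

section \<open>The reduced Burau representation\<close>

definition burau_gen :: "braid_gen \<Rightarrow> laurent ^ 2 ^ 2" where
  "burau_gen g = (case g of
     S1 \<Rightarrow> vector [vector [- T, 1], vector [0, 1]]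
   | S2 \<Rightarrow> vector [vector [1, 0], vector [T, - T]])"

fun burau_word :: "braid_word \<Rightarrow> laurent ^ 2 ^ 2" where
  "burau_word [] = mat 1"
| "burau_word ((g, e) # w) = (if e then matrix_inv (burau_gen g) else burau_gen g) ** burau_word w"

lemma matrix_eq_2:
  "(A :: laurent ^ 2 ^ 2) = B \<longleftrightarrow>
     A $ 1 $ 1 = B $ 1 $ 1 \<and> A $ 1 $ 2 = B $ 1 $ 2 \<and> A $ 2 $ 1 = B $ 2 $ 1 \<and> A $ 2 $ 2 = B $ 2 $ 2"
  by (auto simp: vec_eq_iff forall_2)

lemma matrix_mult_2:
  "((A :: laurent ^ 2 ^ 2) ** B) $ i $ j = A $ i $ 1 * B $ 1 $ j + A $ i $ 2 * B $ 2 $ j"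
  by (simp add: matrix_matrix_mult_def sum_2)

lemma T_inverse: "T * lmonom (- 1) 1 = 1"
  by (simp add: T_def mult_single)

lemma burau_gen_entries:
  "burau_gen S1 $ 1 $ 1 = - T" "burau_gen S1 $ 1 $ 2 = 1"
  "burau_gen S1 $ 2 $ 1 = 0" "burau_gen S1 $ 2 $ 2 = 1"
  "burau_gen S2 $ 1 $ 1 = 1" "burau_gen S2 $ 1 $ 2 = 0"
  "burau_gen S2 $ 2 $ 1 = T" "burau_gen S2 $ 2 $ 2 = - T"
  by (simp_all add: burau_gen_def)

lemma invertible_burau_gen: "invertible (burau_gen g)"
proof (cases g)
  case S1
  let ?B = "vector [vector [- lmonom (- 1) 1, lmonom (- 1) 1], vector [0, 1]] :: laurent ^ 2 ^ 2"
  have "burau_gen S1 ** ?B = mat 1 \<and> ?B ** burau_gen S1 = mat 1"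
    using T_inverse
    by (simp add: matrix_eq_2 matrix_mult_2 burau_gen_entries mat_def mult.commute)
  then show ?thesis unfolding invertible_def S1 by blast
next
  case S2
  let ?B = "vector [vector [1, 0], vector [1, - lmonom (- 1) 1]] :: laurent ^ 2 ^ 2"
  have "burau_gen S2 ** ?B = mat 1 \<and> ?B ** burau_gen S2 = mat 1"
    using T_inverse
    by (simp add: matrix_eq_2 matrix_mult_2 burau_gen_entries mat_def mult.commute)
  then show ?thesis unfolding invertible_def S2 by blast
qed

lemma matrix_inv_burau_gen:
  "burau_gen g ** matrix_inv (burau_gen g) = mat 1"
  "matrix_inv (burau_gen g) ** burau_gen g = mat 1"
  using someI_ex[OF invertible_burau_gen[of g, unfolded invertible_def]]
  unfolding matrix_inv_def by blast+

lemma burau_word_append: "burau_word (u @ v) = burau_word u ** burau_word v"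
  by (induction u rule: burau_word.induct) (simp_all add: matrix_mul_assoc)

lift_definition burau :: "braid3 \<Rightarrow> laurent ^ 2 ^ 2" is burau_word
proof -
  fix u v :: braid_word
  assume "braid_equiv u v"
  then show "burau_word u = burau_word v"
  proof induction
    case (be_cancel g e)
    then show ?case by (simp add: matrix_inv_burau_gen)
  next
    case be_braid
    then show ?case
      by (simp add: matrix_eq_2 matrix_mult_2 burau_gen_entries)
  qed (simp_all add: burau_word_append)
qed

lemma burau_mult: "burau (a * b) = burau a ** burau b"
  by transfer (rule burau_word_append)

lemma burau_one: "burau 1 = mat 1"
  by transfer simp

lemma burau_sigma1: "burau sigma1 = vector [vector [- T, 1], vector [0, 1]]"
  by transfer (simp add: burau_gen_def)

lemma burau_sigma2: "burau sigma2 = vector [vector [1, 0], vector [T, - T]]"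
  by transfer (simp add: burau_gen_def)

section \<open>The Alexander polynomial of the closure of a 3-braid\<close>

(* The integer power (-1/s)^m, where s = sqrt t. *)
definition neg_inv_sqrt_power :: "int \<Rightarrow> laurent" where
  "neg_inv_sqrt_power m = lmonom (- m) (if even m then 1 else - 1)"

(* "D is an Alexander polynomial of the closure of b", with
     D = (-1/sqrt t)^(e_b - 2) * (1 - t) / (1 - t^3) * det (I - burau b)
   up to a unit u of Z[t, 1/t].  Half-integer powers of t occur in this formula when e_b
   is odd, so D is a Laurent polynomial in s = sqrt t.  The ring is an integral domain,
   so the denominator can be moved to the left-hand side. *)
definition alexander_poly_closure :: "braid3 \<Rightarrow> laurent \<Rightarrow> bool" where
  "alexander_poly_closure b D \<longleftrightarrow>
     (\<exists>u :: laurent. u dvd 1 \<and>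
        in_sqrt (1 - T ^ 3) * D =
        in_sqrt u * neg_inv_sqrt_power (exponent_sum b - 2) *
          in_sqrt ((1 - T) * det (mat 1 - burau b)))"

(* The nonzero complex zeroes, in the variable t = s^2, of a Laurent polynomial D in
   s = sqrt t.  By its definition, an Alexander polynomial has only even or only odd powers
   of s, so that it vanishes at both square roots of t or at neither. *)
definition zeroes_in_t :: "laurent \<Rightarrow> complex set" where
  "zeroes_in_t D = {z. z \<noteq> 0 \<and> (\<exists>s. s\<^sup>2 = z \<and> laurent_eval D s = 0)}"

subsection \<open>The quotient by \<open>1 - t^3\<close> exists for every braid\<close>

lemma in_sqrt_superset:
  assumes "finite K" "Poly_Mapping.keys p \<subseteq> K"
  shows "in_sqrt p = (\<Sum>k \<in> K. lmonom (2 * k) (Poly_Mapping.lookup p k))"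
  unfolding in_sqrt_def using assms
  by (intro sum.mono_neutral_left) (auto simp: in_keys_iff)

lemma in_sqrt_add: "in_sqrt (p + q) = in_sqrt p + in_sqrt q"
proof -
  let ?K = "Poly_Mapping.keys p \<union> Poly_Mapping.keys q"
  have "in_sqrt (p + q) = (\<Sum>k \<in> ?K. lmonom (2 * k) (Poly_Mapping.lookup (p + q) k))"
    by (rule in_sqrt_superset) (auto simp: Poly_Mapping.keys_add)
  also have "\<dots> = (\<Sum>k \<in> ?K. lmonom (2 * k) (Poly_Mapping.lookup p k)) +
                  (\<Sum>k \<in> ?K. lmonom (2 * k) (Poly_Mapping.lookup q k))"
    by (simp add: lookup_add single_add sum.distrib)
  finally show ?thesis
    by (simp add: in_sqrt_superset[of ?K p] in_sqrt_superset[of ?K q])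
qed

lemma in_sqrt_single: "in_sqrt (lmonom k c) = lmonom (2 * k) c"
  by (cases "c = 0") (simp_all add: in_sqrt_def)

lemma laurent_induct [case_names zero add]:
  fixes p :: laurent
  assumes zero: "P 0" and add: "\<And>k c p. P p \<Longrightarrow> P (lmonom k c + p)"
  shows "P p"
proof (induction "card (Poly_Mapping.keys p)" arbitrary: p)
  case 0
  then have "p = 0" by simp
  with zero show ?case by simp
next
  case (Suc n)
  then obtain k where k: "k \<in> Poly_Mapping.keys p"
    by (metis card.empty equals0I nat.distinct(1))
  define q where "q = p - lmonom k (Poly_Mapping.lookup p k)"
  have "Poly_Mapping.keys q = Poly_Mapping.keys p - {k}"
    by (auto simp: q_def in_keys_iff lookup_minus lookup_single when_def split: if_splits)
  with k Suc.hyps(2) have "n = card (Poly_Mapping.keys q)"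
    by simp
  then have "P q" by (rule Suc.hyps(1))
  then have "P (lmonom k (Poly_Mapping.lookup p k) + q)" by (rule add)
  then show ?case unfolding q_def by simp
qed

lemma in_sqrt_mult: "in_sqrt (p * q) = in_sqrt p * in_sqrt q"
proof (induction p rule: laurent_induct)
  case zero
  show ?case by (simp add: in_sqrt_def)
next
  case (add k c p)
  have "in_sqrt (lmonom k c * q) = in_sqrt (lmonom k c) * in_sqrt q"
  proof (induction q rule: laurent_induct)
    case zero
    show ?case by (simp add: in_sqrt_def)
  next
    case (add l d q)
    then show ?case
      by (simp add: distrib_left in_sqrt_add mult_single in_sqrt_single)
  qed
  with add show ?case by (simp add: distrib_right in_sqrt_add)
qed

lemma fixed_vector_mult:
  fixes a b :: "'a :: comm_ring_1"
  assumes "m11 + m12 * v = p + f * c" "m21 + m22 * v = q + f * d"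
  shows "(a * m11 + b * m21) + (a * m12 + b * m22) * v = (a * p + b * q) + f * (a * c + b * d)"
proof -
  have "(a * m11 + b * m21) + (a * m12 + b * m22) * v = a * (m11 + m12 * v) + b * (m21 + m22 * v)"
    by (simp add: algebra_simps)
  also have "\<dots> = (a * p + b * q) + f * (a * c + b * d)"
    unfolding assms by (simp add: algebra_simps)
  finally show ?thesis .
qed

lemma eq_add_mult_neg:
  fixes p :: "'a :: comm_ring_1"
  shows "p = q + f * k \<Longrightarrow> q = p + f * - k"
  by simp

(* Modulo 1 + t + t^2 every Burau matrix fixes the vector (1, 1 + t). *)
lemma burau_fixed_vector:
  "\<exists>x y. burau_word w $ 1 $ 1 + burau_word w $ 1 $ 2 * (1 + T) = 1 + (1 + T + T\<^sup>2) * x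
       \<and> burau_word w $ 2 $ 1 + burau_word w $ 2 $ 2 * (1 + T) = 1 + T + (1 + T + T\<^sup>2) * y"
proof (induction w)
  case Nil
  have "burau_word [] $ 1 $ 1 + burau_word [] $ 1 $ 2 * (1 + T) = 1 + (1 + T + T\<^sup>2) * 0
      \<and> burau_word [] $ 2 $ 1 + burau_word [] $ 2 $ 2 * (1 + T) = 1 + T + (1 + T + T\<^sup>2) * 0"
    by (simp add: mat_def)
  then show ?case by blast
next
  case (Cons l w)
  obtain g e where l: "l = (g, e)" by (cases l)
  obtain x y where
    x: "burau_word w $ 1 $ 1 + burau_word w $ 1 $ 2 * (1 + T) = 1 + (1 + T + T\<^sup>2) * x" and
    y: "burau_word w $ 2 $ 1 + burau_word w $ 2 $ 2 * (1 + T) = 1 + T + (1 + T + T\<^sup>2) * y"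
    using Cons.IH by blast
  define A where "A = (if e then matrix_inv (burau_gen g) else burau_gen g)"
  define M where "M = burau_gen g"
  define N where "N = matrix_inv M"
  have NM: "N ** M = mat 1"
    unfolding N_def M_def by (rule matrix_inv_burau_gen)
  have M: "\<exists>c d. M $ 1 $ 1 + M $ 1 $ 2 * (1 + T) = 1 + (1 + T + T\<^sup>2) * c
      \<and> M $ 2 $ 1 + M $ 2 $ 2 * (1 + T) = 1 + T + (1 + T + T\<^sup>2) * d"
  proof (cases g)
    case S1
    show ?thesis
      by (rule exI[of _ 0], rule exI[of _ 0]) (simp add: M_def S1 burau_gen_entries)
  next
    case S2
    show ?thesis
      by (rule exI[of _ 0], rule exI[of _ "- 1"])
         (simp add: M_def S2 burau_gen_entries algebra_simps power2_eq_square)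
  qed
  have "\<exists>c d. A $ 1 $ 1 + A $ 1 $ 2 * (1 + T) = 1 + (1 + T + T\<^sup>2) * c
      \<and> A $ 2 $ 1 + A $ 2 $ 2 * (1 + T) = 1 + T + (1 + T + T\<^sup>2) * d"
  proof (cases e)
    case False
    then show ?thesis using M by (simp add: A_def M_def)
  next
    case True
    then have AN: "A = N" by (simp add: A_def N_def M_def)
    obtain c d where
      c: "M $ 1 $ 1 + M $ 1 $ 2 * (1 + T) = 1 + (1 + T + T\<^sup>2) * c" and
      d: "M $ 2 $ 1 + M $ 2 $ 2 * (1 + T) = 1 + T + (1 + T + T\<^sup>2) * d"
      using M by blast
    have e: "N $ 1 $ 1 * M $ 1 $ 1 + N $ 1 $ 2 * M $ 2 $ 1 = 1"
            "N $ 1 $ 1 * M $ 1 $ 2 + N $ 1 $ 2 * M $ 2 $ 2 = 0"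
            "N $ 2 $ 1 * M $ 1 $ 1 + N $ 2 $ 2 * M $ 2 $ 1 = 0"
            "N $ 2 $ 1 * M $ 1 $ 2 + N $ 2 $ 2 * M $ 2 $ 2 = 1"
      using NM by (auto simp: matrix_eq_2 matrix_mult_2 mat_def)
    have "N $ 1 $ 1 + N $ 1 $ 2 * (1 + T) = 1 + (1 + T + T\<^sup>2) * - (N $ 1 $ 1 * c + N $ 1 $ 2 * d)"
      using fixed_vector_mult[OF c d, of "N $ 1 $ 1" "N $ 1 $ 2"] unfolding e
      by (intro eq_add_mult_neg) simp
    moreover have "N $ 2 $ 1 + N $ 2 $ 2 * (1 + T)
        = 1 + T + (1 + T + T\<^sup>2) * - (N $ 2 $ 1 * c + N $ 2 $ 2 * d)"
      using fixed_vector_mult[OF c d, of "N $ 2 $ 1" "N $ 2 $ 2"] unfolding e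
      by (intro eq_add_mult_neg) simp
    ultimately show ?thesis unfolding AN by blast
  qed
  then obtain c d where
    c: "A $ 1 $ 1 + A $ 1 $ 2 * (1 + T) = 1 + (1 + T + T\<^sup>2) * c" and
    d: "A $ 2 $ 1 + A $ 2 $ 2 * (1 + T) = 1 + T + (1 + T + T\<^sup>2) * d"
    by blast
  define B where "B = burau_word w"
  have AB: "burau_word (l # w) = A ** B"
    by (simp add: l A_def B_def)
  note x = x[folded B_def] and y = y[folded B_def]
  have "(A ** B) $ 1 $ 1 + (A ** B) $ 1 $ 2 * (1 + T)
      = 1 + (1 + T + T\<^sup>2) * (c + A $ 1 $ 1 * x + A $ 1 $ 2 * y)"
    unfolding matrix_mult_2 fixed_vector_mult[OF x y] using c by (simp add: algebra_simps)
  moreover have "(A ** B) $ 2 $ 1 + (A ** B) $ 2 $ 2 * (1 + T)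
      = 1 + T + (1 + T + T\<^sup>2) * (d + A $ 2 $ 1 * x + A $ 2 $ 2 * y)"
    unfolding matrix_mult_2 fixed_vector_mult[OF x y] using d by (simp add: algebra_simps)
  ultimately show ?case unfolding AB by blast
qed

lemma det_burau_word_dvd: "1 + T + T\<^sup>2 dvd det (mat 1 - burau_word w)"
proof -
  define B where "B = burau_word w"
  obtain x y where
    x: "B $ 1 $ 1 + B $ 1 $ 2 * (1 + T) = 1 + (1 + T + T\<^sup>2) * x" and
    y: "B $ 2 $ 1 + B $ 2 $ 2 * (1 + T) = 1 + T + (1 + T + T\<^sup>2) * y"
    using burau_fixed_vector unfolding B_def by blast
  have "det (mat 1 - B) = (1 - B $ 1 $ 1) * (1 - B $ 2 $ 2) - B $ 1 $ 2 * B $ 2 $ 1"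
    by (simp add: det_2 mat_def)
  also have "\<dots> = (1 + T + T\<^sup>2) * - ((1 - B $ 2 $ 2) * x + B $ 1 $ 2 * y)"
  proof -
    have 1: "1 - B $ 1 $ 1 = B $ 1 $ 2 * (1 + T) - (1 + T + T\<^sup>2) * x"
      using x by (simp add: algebra_simps)
    have 2: "B $ 2 $ 1 = (1 - B $ 2 $ 2) * (1 + T) + (1 + T + T\<^sup>2) * y"
      using y by (simp add: algebra_simps)
    show ?thesis
      unfolding 1 2 by (simp add: algebra_simps)
  qed
  finally show ?thesis unfolding B_def by (metis dvd_triv_left)
qed

lemma det_burau_dvd: "1 + T + T\<^sup>2 dvd det (mat 1 - burau b)"
  by transfer (rule det_burau_word_dvd)

lemma alexander_poly_closure_exists: "\<exists>D. alexander_poly_closure b D"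
proof -
  obtain q where q: "det (mat 1 - burau b) = (1 + T + T\<^sup>2) * q"
    using det_burau_dvd by (auto simp: dvd_def)
  have eq: "(1 - T) * det (mat 1 - burau b) = (1 - T ^ 3) * q"
    unfolding q by (simp add: algebra_simps power2_eq_square power3_eq_cube)
  have one: "in_sqrt 1 = 1"
    using in_sqrt_single[of 0 1] by simp
  have "alexander_poly_closure b (neg_inv_sqrt_power (exponent_sum b - 2) * in_sqrt q)"
    unfolding alexander_poly_closure_def eq in_sqrt_mult
    by (rule exI[of _ 1]) (simp add: one mult_ac)
  then show ?thesis by blast
qed

end

theory Submission
  imports Defs
begin

text \<open>
  The matrix \<open>A = \<psi>\<^sub>t(\<sigma>\<^sub>1 \<sigma>\<^sub>2\<^sup>-\<^sup>1)\<close> has determinant \<open>1\<close> and trace \<open>w = 1 - t - 1/t\<close>. If \<open>w = \<lambda> + 1/\<lambda>\<close>, then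
  \<open>det (I - A\<^sup>n) = 2 - \<lambda>\<^sup>n - 1/\<lambda>\<^sup>n = - \<Prod>\<^sub>j (w - 2 cos (2\<pi>j/n))\<close>, where \<open>j\<close> runs from \<open>0\<close> to \<open>n - 1\<close>.
  The factor for \<open>j = 0\<close> is \<open>- (1 + t + t\<^sup>2) / t\<close> and cancels against the quotient \<open>(1 - t) / (1 - t\<^sup>3)\<close>.
  Away from the sixth roots of unity in \<open>s = sqrt t\<close> the cancellation is a division, and at those
  points it follows by continuity. Every other factor gives the quadratic
  equation \<open>t\<^sup>2 + (2 cos (2\<pi>j/n) - 1) t + 1 = 0\<close>, the same for \<open>j\<close> and \<open>n - j\<close>.
\<close>

section \<open>Evaluation of Laurent polynomials\<close>

lemma laurent_eval_superset:
  assumes "finite K" "Poly_Mapping.keys p \<subseteq> K"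
  shows "laurent_eval p z = (\<Sum>k \<in> K. of_int (Poly_Mapping.lookup p k) * z powi k)"
  unfolding laurent_eval_def using assms
  by (intro sum.mono_neutral_left) (auto simp: in_keys_iff)

lemma laurent_eval_zero [simp]: "laurent_eval 0 z = 0"
  by (simp add: laurent_eval_def)

lemma laurent_eval_single [simp]: "laurent_eval (lmonom k c) z = of_int c * z powi k"
  by (cases "c = 0") (simp_all add: laurent_eval_def)

lemma laurent_eval_one [simp]: "laurent_eval 1 z = 1"
  using laurent_eval_single[of 0 1 z] by simp

lemma laurent_eval_numeral [simp]: "laurent_eval (numeral m) z = numeral m"
  using laurent_eval_single[of 0 "numeral m" z] by simp

lemma laurent_eval_T [simp]: "laurent_eval T z = z"
  by (simp add: T_def)

lemma laurent_eval_add [simp]: "laurent_eval (p + q) z = laurent_eval p z + laurent_eval q z"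
proof -
  let ?K = "Poly_Mapping.keys p \<union> Poly_Mapping.keys q"
  have "laurent_eval (p + q) z = (\<Sum>k \<in> ?K. of_int (Poly_Mapping.lookup (p + q) k) * z powi k)"
    by (rule laurent_eval_superset) (auto simp: Poly_Mapping.keys_add)
  also have "\<dots> = laurent_eval p z + laurent_eval q z"
    by (simp add: laurent_eval_superset[of ?K p] laurent_eval_superset[of ?K q]
        lookup_add algebra_simps sum.distrib)
  finally show ?thesis .
qed

lemma laurent_eval_minus [simp]: "laurent_eval (- p) z = - laurent_eval p z"
  using laurent_eval_add[of p "- p" z] by (simp add: eq_neg_iff_add_eq_0 add.commute)

lemma laurent_eval_diff [simp]: "laurent_eval (p - q) z = laurent_eval p z - laurent_eval q z"
  using laurent_eval_add[of p "- q" z] by simp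

text \<open>Bilinearity reduces this to monomials, where it is the addition law for exponents. That
  law fails at 0: \<open>T * lmonom (- 1) 1\<close> is 1, but both factors evaluate to 0
  there.\<close>

lemma laurent_eval_mult [simp]:
  assumes "z \<noteq> 0"
  shows "laurent_eval (p * q) z = laurent_eval p z * laurent_eval q z"
proof (induction p rule: laurent_induct)
  case zero
  show ?case by simp
next
  case (add k c p)
  have "laurent_eval (lmonom k c * q) z = laurent_eval (lmonom k c) z * laurent_eval q z"
  proof (induction q rule: laurent_induct)
    case zero
    show ?case by simp
  next
    case (add l d q)
    then show ?case
      using assms by (simp add: distrib_left mult_single power_int_add)
  qed
  with add show ?case by (simp add: distrib_right)
qed

lemma laurent_eval_power [simp]:
  "z \<noteq> 0 \<Longrightarrow> laurent_eval (p ^ m) z = laurent_eval p z ^ m"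
  by (induction m) simp_all

lemma laurent_eval_in_sqrt [simp]: "laurent_eval (in_sqrt p) s = laurent_eval p (s\<^sup>2)"
proof (induction p rule: laurent_induct)
  case zero
  show ?case by (simp add: in_sqrt_def)
next
  case (add k c p)
  then show ?case by (simp add: in_sqrt_add in_sqrt_single power_int_mult)
qed

text \<open>A ring homomorphism maps units to units, so the unit in the Alexander polynomial has no
  influence on its nonzero zeroes.\<close>

lemma laurent_eval_unit:
  assumes "u dvd 1" "z \<noteq> 0"
  shows "laurent_eval u z \<noteq> 0"
proof -
  obtain v where "1 = u * v" using assms(1) by (rule dvdE)
  then have "laurent_eval u z * laurent_eval v z = 1"
    using assms(2) by (metis laurent_eval_mult laurent_eval_one)
  then show ?thesis by auto
qed

lemma continuous_laurent_eval:
  assumes "z \<noteq> 0"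
  shows "isCont (laurent_eval p) z"
proof -
  have "isCont (\<lambda>z. \<Sum>k \<in> Poly_Mapping.keys p. of_int (Poly_Mapping.lookup p k) * z powi k) z"
    using assms by (intro continuous_intros) auto
  then show ?thesis by (simp add: laurent_eval_def[abs_def])
qed

section \<open>The Burau matrix of the weaving braid\<close>

abbreviation weaving_trace :: laurent where
  "weaving_trace \<equiv> 1 - T - lmonom (- 1) 1"

text \<open>\<open>matrix_inv\<close> is a choice, so its entries cannot be computed directly. The
  left inverse given by the group law must equal the explicit right inverse.\<close>

lemma burau_inverse_sigma2:
  "burau (inverse sigma2) = vector [vector [1, 0], vector [1, - lmonom (- 1) 1]]" (is "?N = ?B")
proof -
  have left: "?N ** burau sigma2 = mat 1"
    by (metis burau_mult burau_one group.left_inverse group_braid3)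
  have right: "burau sigma2 ** ?B = mat 1"
    using T_inverse by (simp add: matrix_eq_2 matrix_mult_2 burau_sigma2 mat_def)
  have "?N = ?N ** (burau sigma2 ** ?B)"
    unfolding right by simp
  also have "\<dots> = ?B"
    unfolding matrix_mul_assoc left by simp
  finally show ?thesis .
qed

lemma burau_weaving_step:
  "burau (sigma1 * inverse sigma2) =
     vector [vector [1 - T, - lmonom (- 1) 1], vector [1, - lmonom (- 1) 1]]"
  by (simp add: matrix_eq_2 matrix_mult_2 burau_mult burau_sigma1 burau_inverse_sigma2)

lemma det_burau_weaving: "det (burau (weaving_braid m)) = 1"
proof (induction m)
  case 0
  show ?case by (simp add: weaving_braid_def burau_one)
next
  case (Suc m)
  have "det (burau (sigma1 * inverse sigma2)) = 1"
    by (simp add: det_2 burau_weaving_step algebra_simps T_inverse)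
  with Suc show ?case
    by (simp add: weaving_braid_def burau_mult det_mul)
qed

text \<open>This is the trace of A^2 B, where A^2 = (tr A) A - I by Cayley-Hamilton. With B a power
  of A it yields a linear recurrence for the traces of powers.\<close>

lemma cayley_hamilton_trace_2:
  fixes A B :: "laurent ^ 2 ^ 2"
  assumes "det A = 1"
  shows "trace (A ** (A ** B)) = trace A * trace (A ** B) - trace B"
proof -
  define a b c d where "a = A $ 1 $ 1" and "b = A $ 1 $ 2" and "c = A $ 2 $ 1" and "d = A $ 2 $ 2"
  have ad: "a * d = 1 + b * c"
    using assms by (simp add: det_2 a_def b_def c_def d_def algebra_simps)
  have "trace (A ** (A ** B)) - trace A * trace (A ** B) = (b * c - a * d) * trace B"
    by (simp add: trace_def sum_2 matrix_mult_2 a_def b_def c_def d_def algebra_simps)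
  then show ?thesis using ad by (simp add: algebra_simps)
qed

lemma trace_burau_weaving_rec:
  "trace (burau (weaving_braid (Suc (Suc m)))) =
     weaving_trace * trace (burau (weaving_braid (Suc m))) - trace (burau (weaving_braid m))"
proof -
  let ?A = "burau (sigma1 * inverse sigma2)"
  have "det ?A = 1"
    using det_burau_weaving[of 1] by (simp add: weaving_braid_def)
  moreover have "trace ?A = weaving_trace"
    by (simp add: trace_def sum_2 burau_weaving_step)
  moreover have "burau (weaving_braid (Suc k)) = ?A ** burau (weaving_braid k)" for k
    unfolding weaving_braid_def power_Suc burau_mult[of "sigma1 * inverse sigma2"] ..
  ultimately show ?thesis
    using cayley_hamilton_trace_2[of ?A] by simp
qed

text \<open>The evaluated matrix of one step has determinant 1 and trace \<open>l + 1 / l\<close>,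
  so its eigenvalues are \<open>l\<close> and \<open>1 / l\<close>. Following the recurrence instead
  of diagonalising also covers the case \<open>l = 1 / l\<close>.\<close>

lemma eval_trace_burau_weaving:
  assumes "z \<noteq> 0" "l \<noteq> 0" and w: "l + 1 / l = 1 - z - 1 / z"
  shows "laurent_eval (trace (burau (weaving_braid m))) z = l ^ m + 1 / l ^ m"
proof (induction m rule: less_induct)
  case (less m)
  consider "m = 0" | "m = 1" | k where "m = Suc (Suc k)"
    by (metis One_nat_def nat.exhaust)
  then show ?case
  proof cases
    case 1
    then show ?thesis
      by (simp add: weaving_braid_def burau_one trace_def sum_2 mat_def)
  next
    case 2
    have "trace (burau (weaving_braid m)) = weaving_trace"
      using 2 by (simp add: weaving_braid_def trace_def sum_2 burau_weaving_step)
    then show ?thesis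
      using 2 w by (simp add: power_int_minus inverse_eq_divide)
  next
    case (3 k)
    have "laurent_eval (trace (burau (weaving_braid m))) z
        = (1 - z - 1 / z) * (l ^ Suc k + 1 / l ^ Suc k) - (l ^ k + 1 / l ^ k)"
      using 3 assms(1) less[of k] less[of "Suc k"]
      by (simp add: trace_burau_weaving_rec power_int_minus inverse_eq_divide)
    also have "\<dots> = l ^ m + 1 / l ^ m"
      unfolding w[symmetric] using assms(2) 3 by (simp add: field_simps)
    finally show ?thesis .
  qed
qed

lemma eval_det_burau_weaving:
  assumes "z \<noteq> 0" "l \<noteq> 0" "l + 1 / l = 1 - z - 1 / z"
  shows "laurent_eval (det (mat 1 - burau (weaving_braid m))) z = 2 - (l ^ m + 1 / l ^ m)"
proof -
  let ?B = "burau (weaving_braid m)"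
  have "det (mat 1 - ?B) = 1 + det ?B - trace ?B"
    by (simp add: det_2 trace_def sum_2 mat_def algebra_simps)
  then show ?thesis
    using eval_trace_burau_weaving[OF assms, of m] det_burau_weaving[of m] by simp
qed

section \<open>Factorisation over the roots of unity\<close>

text \<open>Both sides are monic of degree \<open>n\<close> and share \<open>n\<close> distinct
  roots. A nonzero difference would have degree at least \<open>n\<close>, but its coefficient there
  is 1 - 1 = 0.\<close>

lemma prod_roots_of_unity:
  fixes x :: complex
  assumes "n \<ge> 1"
  shows "x ^ n - 1 = (\<Prod>z | z ^ n = 1. x - z)"
proof -
  let ?R = "{z :: complex. z ^ n = 1}"
  define p where "p = monom 1 n - (1 :: complex poly)"
  define q where "q = (\<Prod>z \<in> ?R. [:- z, 1:])"
  have fin: "finite ?R" and card: "card ?R = n"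
    using assms by (auto simp: finite_roots_unity card_roots_unity_eq)
  have p: "degree p = n" "coeff p n = 1"
    using assms degree_add_eq_left[of "- 1" "monom (1 :: complex) n"]
    by (simp_all add: p_def degree_monom_eq)
  have q: "degree q = n"
    using card by (simp add: q_def degree_prod_eq_sum_degree)
  have lq: "coeff q n = 1"
    using lead_coeff_prod[of "\<lambda>z :: complex. [:- z, 1:]" ?R] q by (simp add: q_def)
  have "p - q = 0"
  proof (rule ccontr)
    assume nz: "p - q \<noteq> 0"
    have "?R \<subseteq> {x. poly (p - q) x = 0}"
      using fin by (auto simp: p_def q_def poly_monom poly_prod prod_zero_iff)
    then have "n \<le> card {x. poly (p - q) x = 0}"
      using card poly_roots_finite[OF nz] by (metis card_mono)
    also have "\<dots> \<le> degree (p - q)"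
      using nz by (rule card_poly_roots_bound)
    finally have "degree (p - q) = n"
      using degree_diff_le[of p n q] p q by simp
    then have "lead_coeff (p - q) = 0"
      using p lq by simp
    with nz show False by (simp only: leading_coeff_0_iff)
  qed
  then have "poly p x = poly q x" by simp
  then show ?thesis
    by (simp add: p_def q_def poly_monom poly_prod)
qed

lemma prod_roots_of_unity_cis:
  assumes "n \<ge> 1"
  shows "x ^ n - 1 = (\<Prod>j<n. x - cis (2 * pi * real j / real n))"
  unfolding prod_roots_of_unity[OF assms]
  using prod.reindex_bij_betw[OF Complex.bij_betw_roots_unity[of n], of "\<lambda>z. x - z"] assms by simp

text \<open>Up to sign, the left side is \<open>(l ^ n - 1) * ((1 / l) ^ n - 1)\<close>. Both
  factors split over the same roots of unity c, and the two terms for each c are paired, using c +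
  1/c = 2 Re c.\<close>

lemma power_plus_inverse_minus_2:
  fixes l :: complex
  assumes "n \<ge> 1" "l \<noteq> 0"
  shows "l ^ n + 1 / l ^ n - 2 = (\<Prod>j<n. l + 1 / l - of_real (2 * cos (2 * pi * real j / real n)))"
proof -
  let ?c = "\<lambda>j. cis (2 * pi * real j / real n)"
  have eq: "(l - ?c j) * (1 / l - ?c j) =
      - ?c j * (l + 1 / l - of_real (2 * cos (2 * pi * real j / real n)))" for j
  proof -
    have "of_real (2 * cos (2 * pi * real j / real n)) = ?c j + cnj (?c j)"
      by (simp add: complex_add_cnj)
    moreover have "?c j * cnj (?c j) = 1"
      by (simp add: complex_mult_cnj cmod_power2[symmetric])
    ultimately show ?thesis
      using assms(2) by (simp add: field_simps)
  qed
  \<comment> \<open>The factorisation of \<open>x ^ n - 1\<close> at \<open>x = 0\<close>.\<close>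
  have "(\<Prod>j<n. - ?c j) = - 1"
    using prod_roots_of_unity_cis[OF assms(1), of 0] assms(1) by (simp add: zero_power)
  then have eq_prod: "(l ^ n - 1) * ((1 / l) ^ n - 1) =
      - (\<Prod>j<n. l + 1 / l - of_real (2 * cos (2 * pi * real j / real n)))"
    unfolding prod_roots_of_unity_cis[OF assms(1)] prod.distrib[symmetric] eq
    by (simp only: prod.distrib) simp
  have "(l ^ n - 1) * ((1 / l) ^ n - 1) = 2 - l ^ n - 1 / l ^ n"
    using assms(2) by (simp add: power_one_over field_simps)
  with eq_prod show ?thesis
    by (metis diff_diff_eq minus_diff_eq minus_minus)
qed

lemma ex_add_inverse_eq:
  fixes w :: complex
  shows "\<exists>l. l \<noteq> 0 \<and> l + 1 / l = w"
proof -
  define l where "l = (w + csqrt (w\<^sup>2 - 4)) / 2"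
  have "(csqrt (w\<^sup>2 - 4))\<^sup>2 = w\<^sup>2 - 4" by simp
  \<comment> \<open>\<open>l\<close> and \<open>w - l\<close> are the two roots of X^2 - w X +
    1.\<close>
  then have "l * (w - l) = 1"
    by (simp add: l_def field_simps power2_eq_square)
  moreover from this have "l \<noteq> 0" by auto
  ultimately show ?thesis
    by (intro exI[of _ l]) (auto simp: field_simps)
qed

lemma eval_det_burau_weaving_prod:
  assumes "n \<ge> 1" "z \<noteq> 0"
  shows "laurent_eval (det (mat 1 - burau (weaving_braid n))) z =
    (1 + z + z\<^sup>2) / z * (\<Prod>j=1..<n. 1 - z - 1 / z - of_real (2 * cos (2 * pi * real j / real n)))"
proof -
  obtain l where l: "l \<noteq> 0" "l + 1 / l = 1 - z - 1 / z"
    using ex_add_inverse_eq by blast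
  let ?f = "\<lambda>j. 1 - z - 1 / z - of_real (2 * cos (2 * pi * real j / real n))"
  have "laurent_eval (det (mat 1 - burau (weaving_braid n))) z = - (l ^ n + 1 / l ^ n - 2)"
    using eval_det_burau_weaving[OF assms(2) l, of n] by simp
  also have "\<dots> = - (\<Prod>j<n. ?f j)"
    unfolding power_plus_inverse_minus_2[OF assms(1) l(1)] l(2) ..
  also have "(\<Prod>j<n. ?f j) = ?f 0 * (\<Prod>j=1..<n. ?f j)"
    using assms(1) by (simp add: lessThan_atLeast0 prod.atLeast_Suc_lessThan)
  also have "?f 0 = - ((1 + z + z\<^sup>2) / z)"
    using assms(2) by (simp add: field_simps power2_eq_square)
  finally show ?thesis by simp
qed

section \<open>The zeroes of the Alexander polynomial\<close>

text \<open>Off finitely many points \<open>h\<close> can be divided out, so \<open>f\<close> and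
  \<open>g\<close> agree on a punctured neighbourhood of \<open>a\<close> and have the same limit
  there.\<close>

lemma cancel_isolated_zeroes:
  fixes f g :: "complex \<Rightarrow> complex"
  assumes "finite {x. h x = 0}" "isCont f a" "isCont g a" "a \<noteq> 0"
    and eq: "\<And>x. x \<noteq> 0 \<Longrightarrow> h x * f x = h x * g x"
  shows "f a = g a"
proof -
  \<comment> \<open>\<open>a\<close> may itself be a zero of \<open>h\<close>; removing it makes the
    complement a neighbourhood of \<open>a\<close>. The point 0 is added because \<open>eq\<close>
    does not cover it.\<close>
  let ?S = "insert 0 {x. h x = 0} - {a}"
  have "closed ?S"
    using assms(1) by (intro finite_imp_closed) simp
  then have "open (- ?S)" by (rule open_Compl)
  then have "\<forall>\<^sub>F x in at a. f x = g x"
    unfolding eventually_at_topological using eq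
    by (intro exI[of _ "- ?S"] conjI) auto
  moreover have "f \<midarrow>a\<rightarrow> f a" "g \<midarrow>a\<rightarrow> g a"
    using assms(2,3) by (simp_all add: isCont_def)
  ultimately show ?thesis
    by (metis at_neq_bot tendsto_cong tendsto_unique)
qed

lemma alexander_weaving_eval_eq_0_iff:
  assumes n: "n \<ge> 1" and D: "alexander_poly_closure (weaving_braid n) D" and s: "s \<noteq> 0"
  shows "laurent_eval D s = 0 \<longleftrightarrow>
    (\<exists>j \<in> {1..<n}. 1 - s\<^sup>2 - 1 / s\<^sup>2 = of_real (2 * cos (2 * pi * real j / real n)))"
proof -
  let ?P = "\<lambda>x. \<Prod>j=1..<n. 1 - x\<^sup>2 - 1 / x\<^sup>2 - complex_of_real (2 * cos (2 * pi * real j / real n))"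
  define e where "e = neg_inv_sqrt_power (exponent_sum (weaving_braid n) - 2)"
  obtain u where u: "u dvd 1" and eq: "in_sqrt (1 - T ^ 3) * D =
      in_sqrt u * e * in_sqrt ((1 - T) * det (mat 1 - burau (weaving_braid n)))"
    using D unfolding alexander_poly_closure_def e_def by blast
  let ?g = "\<lambda>x. laurent_eval (in_sqrt u) x * laurent_eval e x / x\<^sup>2 * ?P x"
  \<comment> \<open>The value of \<open>in_sqrt (1 - T ^ 3)\<close> at x is 1 - x^6, which may
    vanish at \<open>s\<close>. The divisor x^2 in \<open>?g\<close> is left over from the factor
    for j = 0.\<close>
  have "laurent_eval D s = ?g s"
  proof (rule cancel_isolated_zeroes[where h = "\<lambda>x. 1 - x ^ 6"
        and f = "laurent_eval D" and g = ?g])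
    have "{x :: complex. 1 - x ^ 6 = 0} = {x. x ^ 6 = 1}"
      by auto
    then show "finite {x :: complex. 1 - x ^ 6 = 0}"
      using finite_roots_unity[of 6, where 'a = complex] by simp
    show "isCont (laurent_eval D) s"
      using s by (rule continuous_laurent_eval)
    show "isCont ?g s"
      using s by (intro continuous_intros continuous_laurent_eval) auto
    fix x :: complex
    assume x: "x \<noteq> 0"
    have "(1 - x ^ 6) * laurent_eval D x = laurent_eval (in_sqrt (1 - T ^ 3) * D) x"
      using x by (simp add: power_mult[symmetric])
    also have "\<dots> = laurent_eval (in_sqrt u) x * laurent_eval e x *
        ((1 - x\<^sup>2) * ((1 + x\<^sup>2 + (x\<^sup>2)\<^sup>2) / x\<^sup>2 * ?P x))"
      unfolding eq using x eval_det_burau_weaving_prod[OF n, of "x\<^sup>2"] by simp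
    also have "\<dots> = (1 - x\<^sup>2) * (1 + x\<^sup>2 + (x\<^sup>2)\<^sup>2) * ?g x"
      by simp
    also have "(1 - x\<^sup>2) * (1 + x\<^sup>2 + (x\<^sup>2)\<^sup>2) = 1 - x ^ 6"
      by (simp add: algebra_simps flip: power_mult power_add)
    finally show "(1 - x ^ 6) * laurent_eval D x = (1 - x ^ 6) * ?g x" .
  qed fact
  moreover have "laurent_eval e s \<noteq> 0"
    using s by (simp add: e_def neg_inv_sqrt_power_def)
  moreover have "laurent_eval (in_sqrt u) s \<noteq> 0"
    using laurent_eval_unit[OF u] s by simp
  ultimately show ?thesis
    using s by (simp add: prod_zero_iff)
qed

text \<open>Multiplying by \<open>z\<close> gives z^2 + (2c - 1) z + 1 = 0, which already excludes
  \<open>z = 0\<close>. Both signs occur, so \<open>r\<close> can be either square root.\<close>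

lemma weaving_quadratic:
  fixes z r :: complex and c :: real
  assumes "r\<^sup>2 = (complex_of_real (2 * c - 1))\<^sup>2 - 4"
  shows "z \<noteq> 0 \<and> 1 - z - 1 / z = of_real (2 * c) \<longleftrightarrow>
    z = - (1 / 2) * (of_real (2 * c - 1) + r) \<or> z = - (1 / 2) * (of_real (2 * c - 1) - r)"
proof -
  let ?a = "complex_of_real (2 * c - 1)"
  have "z \<noteq> 0 \<and> 1 - z - 1 / z = of_real (2 * c) \<longleftrightarrow> z\<^sup>2 + ?a * z + 1 = 0"
    by (cases "z = 0") (auto simp: field_simps power2_eq_square)
  also have "\<dots> \<longleftrightarrow> (2 * z + ?a)\<^sup>2 = r\<^sup>2"
  proof -
    \<comment> \<open>Completing the square.\<close>
    have "(2 * z + ?a)\<^sup>2 - r\<^sup>2 = 4 * (z\<^sup>2 + ?a * z + 1)"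
      unfolding assms by (simp add: algebra_simps power2_eq_square)
    then show ?thesis
      by (metis eq_iff_diff_eq_0 mult_eq_0_iff zero_neq_numeral)
  qed
  also have "\<dots> \<longleftrightarrow> 2 * z + ?a = r \<or> 2 * z + ?a = - r"
    by (rule power2_eq_iff)
  also have "\<dots> \<longleftrightarrow> z = - (1 / 2) * (?a + r) \<or> z = - (1 / 2) * (?a - r)"
    by (auto simp: field_simps)
  finally show ?thesis .
qed

lemma cos_roots_of_unity_half:
  "(\<exists>j \<in> {1..<n}. P (cos (2 * pi * real j / real n))) \<longleftrightarrow>
   (\<exists>k. 1 \<le> k \<and> k \<le> n div 2 \<and> P (cos (2 * pi * real k / real n)))"
proof
  assume "\<exists>j \<in> {1..<n}. P (cos (2 * pi * real j / real n))"
  then obtain j where j: "1 \<le> j" "j < n" "P (cos (2 * pi * real j / real n))" by auto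
  show "\<exists>k. 1 \<le> k \<and> k \<le> n div 2 \<and> P (cos (2 * pi * real k / real n))"
  proof (cases "j \<le> n div 2")
    case False
    \<comment> \<open>An index above \<open>n div 2\<close> is reflected to \<open>n - j\<close>,
      which is at most \<open>n div 2\<close> and has the same cosine.\<close>
    have "2 * pi * real (n - j) / real n = 2 * pi - 2 * pi * real j / real n"
      using j by (simp add: of_nat_diff field_simps)
    then have "cos (2 * pi * real (n - j) / real n) = cos (2 * pi * real j / real n)"
      by (simp add: cos_diff)
    then show ?thesis
      using j False by (intro exI[of _ "n - j"]) auto
  qed (use j in blast)
\<comment> \<open>Conversely, 1 \<le> k \<le> \<open>n div 2\<close> forces k < n.\<close>
qed force

theorem proposition5p1:
  fixes n :: nat and D :: laurent
  assumes "n \<ge> 1"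
    and "alexander_poly_closure (weaving_braid n) D"
  shows "zeroes_in_t D =
    {z. \<exists>k :: nat. 1 \<le> k \<and> k \<le> n div 2 \<and>
        (let a = 2 * cos (2 * real k / real n * pi) - 1;
             r = csqrt (complex_of_real (a\<^sup>2 - 4))
         in z = - (1 / 2) * (complex_of_real a + r) \<or> z = - (1 / 2) * (complex_of_real a - r))}"
proof (rule set_eqI)
  fix z :: complex
  have "z \<in> zeroes_in_t D \<longleftrightarrow> z \<noteq> 0 \<and>
      (\<exists>j \<in> {1..<n}. 1 - z - 1 / z = of_real (2 * cos (2 * pi * real j / real n)))"
  proof (cases "z = 0")
    case False
    have "\<exists>s. s\<^sup>2 = z" by (rule exI[of _ "csqrt z"]) simp
    \<comment> \<open>The criterion involves \<open>s\<close> only through its square, so either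
      square root of \<open>z\<close> may serve as witness.\<close>
    moreover have "laurent_eval D s = 0 \<longleftrightarrow>
        (\<exists>j \<in> {1..<n}. 1 - z - 1 / z = of_real (2 * cos (2 * pi * real j / real n)))"
      if "s\<^sup>2 = z" for s
      using alexander_weaving_eval_eq_0_iff[OF assms, of s] that False
      by (metis zero_power2)
    ultimately show ?thesis
      using False unfolding zeroes_in_t_def by blast
  qed (simp add: zeroes_in_t_def)
  also have "\<dots> \<longleftrightarrow> (\<exists>k. 1 \<le> k \<and> k \<le> n div 2 \<and>
      (z \<noteq> 0 \<and> 1 - z - 1 / z = of_real (2 * cos (2 * real k / real n * pi))))"
    using cos_roots_of_unity_half[of n "\<lambda>c. 1 - z - 1 / z = of_real (2 * c)"]
    by (auto simp: mult_ac)
  also have "\<dots> \<longleftrightarrow> z \<in> {z. \<exists>k :: nat. 1 \<le> k \<and> k \<le> n div 2 \<and>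
        (let a = 2 * cos (2 * real k / real n * pi) - 1;
             r = csqrt (complex_of_real (a\<^sup>2 - 4))
         in z = - (1 / 2) * (complex_of_real a + r) \<or> z = - (1 / 2) * (complex_of_real a - r))}"
  proof -
    \<comment> \<open>\<open>csqrt\<close> squares to its argument even when that is negative, so
      real and non-real zeroes need no separate treatment.\<close>
    have "(csqrt (complex_of_real ((2 * c - 1)\<^sup>2 - 4)))\<^sup>2 = (complex_of_real (2 * c - 1))\<^sup>2 - 4" for c
      by simp
    from weaving_quadratic[OF this] show ?thesis
      unfolding Let_def mem_Collect_eq by blast
  qed
  finally show "z \<in> zeroes_in_t D \<longleftrightarrow> z \<in> {z. \<exists>k :: nat. 1 \<le> k \<and> k \<le> n div 2 \<and>
        (let a = 2 * cos (2 * real k / real n * pi) - 1;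
             r = csqrt (complex_of_real (a\<^sup>2 - 4))
         in z = - (1 / 2) * (complex_of_real a + r) \<or> z = - (1 / 2) * (complex_of_real a - r))}" .
qed

end
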